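(* Let $\lambda_0>0$ and suppose $\lambda_1\ge 8\lambda_0$. Assume: (1) the margin condition holds with a strictly convex function $G$ (with convex conjugate $H$), i.e. $\Xi(f)\ge G(\|f-f^0\|)$ for all $f\in\mathbf F_{\text{local}}$; (2) $f^*\in\mathbf F_{\text{local}}$, and $f_\beta\in\mathbf F_{\text{local}}$ for all $\beta$ with $\|\beta-\beta^*\|_1\le M^*$; (3) the adaptive restricted eigenvalue condition holds for $S^*$, i.e. $\phi_*=\phi(S^* )>0$. Then on the event $\tau=\{Z_{M^*}\le\lambda_0M^*\}$ one has $$\Xi(\hat f)+\lambda_1\|\hat\beta-\beta^*\|_1+\lambda_2\|\hat\beta_{S^*}-\beta^*_{S^*}\|_2^2\le 4\Delta^*=6\,\Xi(f^* )+4H\!\left(\frac{4\lambda_1\sqrt{s^*}+4\lambda_2\|\beta^*\|_2}{\phi_*}\right).$$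
   Context: Setting. $Z_i=(X_i,Y_i)$, $i=1,\dots,n$, is an independent sample on a probability space $(\Omega,\mathcal F,P)$ with values in $\mathcal Z=\mathcal X\times\mathcal Y$, $\mathcal Y\subseteq\mathbb R$. $\mathbf F$ is a normed real vector space, with norm $\|\cdot\|$, of functions $f:\mathcal X\to\mathbb R$. For each $f\in\mathbf F$, $\rho_f:\mathcal Z\to\mathbb R$ is a loss function, and $f\mapsto\rho_f(z)$ is convex for every $z\in\mathcal Z$. Put $P_n\rho_f=\frac1n\sum_{i=1}^n\rho_f(Z_i)$ and $P\rho_f=\frac1n\sum_{i=1}^nE\rho_f(Z_i)$. The target is $f^0=\arg\min_{f\in\mathbf F}P\rho_f$, assumed to exist and be unique, and the excess risk is $\Xi(f)=P(\rho_f-\rho_{f^0})\ge0$. Given $\psi_1,\dots,\psi_p\in\mathbf F$, let $f_\beta=\sum_{j=1}^p\beta_j\psi_j$ for $\beta\in\mathbb R^p$. Let $\Phi\subseteq\mathbb R^p$ be convex and $\mathcal F_L=\{f_\beta:\beta\in\Phi\}$. For $\lambda_1,\lambda_2>0$ the elastic net estimator is $\hat f=f_{\hat\beta}$, where $\hat\beta$ minimizes $P_n\rho_{f_\beta}+\lambda_1\|\beta\|_1+\lambda_2\|\beta\|_2^2$ over $\beta\in\Phi$. $\|f\|_\infty=\sup_{x\in\mathcal X}|f(x)|$, and $\mathbf F_{\text{local}}=\{f\in\mathbf F:\|f-f^0\|_\infty\le\eta\}$ for a given $\eta>0$. $G$ is a strictly convex function on $[0,\infty)$ with $G(0)=0$,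 and its convex conjugate is $H(v)=\sup_{u\ge0}\{uv-G(u)\}$, $v\ge0$. For $S\subseteq\{1,\dots,p\}$, $\beta_S$ denotes the vector with entries $\beta_j1_{\{j\in S\}}$, and $S^c$ is the complement of $S$. For $b\in\mathbb R^p$ let $S_b=\{j:b_j\ne0\}$, $s_b=|S_b|$. The adaptive restricted eigenvalue attached to $b$ and $S=S_b$ is given by $$\phi^2(S)=\min\Big\{\frac{\|f_\beta\|^2}{\|\beta_S\|_2^2}:\beta\in\mathbb R^p\setminus\{0\},\ \|\beta_{S^c}\|_1\le L_n\|\beta_S\|_2\Big\},\qquad L_n=3\Big(\sqrt{|S|}+\frac{2\lambda_2\|b_S\|_2}{\lambda_1}\Big),$$ with $b$ fixed in the minimization (the dependence on $b$ is suppressed in the notation $\phi(S)$). Given a collection $\Gamma$ of subsets of $\{1,\dots,p\}$, the oracle is $$\beta^*=\arg\min_{\beta\in\mathbb R^p:\,S_\beta\in\Gamma}\Big\{3\,\Xi(f_\beta)+2H\Big(\frac{4\lambda_1\sqrt{s_\beta}+4\lambda_2\|\beta\|_2}{\phi(S_\beta)}\Big)\Big\}.$$ Put $S^*=S_{\beta^*}$, $s^*=|S^*|$, $\phi_*=\phi(S^* )$ (with $L_n$ computed from $b=\beta^*$), $f^*=f_{\beta^*}$, and $$2\Delta^*=3\,\Xi(f^* )+2H\Big(\frac{4\lambda_1\sqrt{s^*}+4\lambda_2\|\beta^*\|_2}{\phi_*}\Big),\qquad M^*=\Delta^*/\lambda_0.$$ Finally, $V_n(\beta)=\frac1n\sum_{i=1}^n[\rho_{f_\beta}(Z_i)-E\rho_{f_\beta}(Z_i)]$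 for $\beta\in\mathbb R^p$, and $Z_M=\sup_{\|\beta-\beta^*\|_1\le M}|V_n(\beta)-V_n(\beta^* )|$, the supremum being over $\beta\in\mathbb R^p$.
   Formalization: Two hypotheses are added, as the claim fails without them: β* ∈ Φ (else Φ could be a single point far from β* ), and M* > 0, i.e. Δ* > 0 (if Δ* = 0 then τ = Ω and the claim would force β̂ = β* always, which noise refutes). All E ρ_f(Z_i) are taken finite. *)

theory Defs
  imports "HOL-Probability.Probability" "HOL-Library.Function_Algebras"
begin

instantiation "fun" :: (type, real_vector) real_vector
begin

definition scaleR_fun :: "real \<Rightarrow> ('a \<Rightarrow> 'b) \<Rightarrow> 'a \<Rightarrow> 'b" where
  "scaleR_fun c f = (\<lambda>x. c *\<^sub>R f x)"

instance
  by standard (simp_all add: scaleR_fun_def fun_eq_iff scaleR_add_left scaleR_add_right)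

end

definition is_norm_on :: "('v::real_vector) set \<Rightarrow> ('v \<Rightarrow> real) \<Rightarrow> bool" where
  "is_norm_on F nrm \<longleftrightarrow>
     (\<forall>f\<in>F. nrm f \<ge> 0) \<and>
     (\<forall>f\<in>F. nrm f = 0 \<longleftrightarrow> f = 0) \<and>
     (\<forall>f\<in>F. \<forall>c. nrm (c *\<^sub>R f) = \<bar>c\<bar> * nrm f) \<and>
     (\<forall>f\<in>F. \<forall>g\<in>F. nrm (f + g) \<le> nrm f + nrm g)"

definition strictly_convex_on :: "('v::real_vector) set \<Rightarrow> ('v \<Rightarrow> real) \<Rightarrow> bool" where
  "strictly_convex_on S f \<longleftrightarrow> convex S \<and>
     (\<forall>x\<in>S. \<forall>y\<in>S. \<forall>t. x \<noteq> y \<longrightarrow> 0 < t \<longrightarrow> t < 1 \<longrightarrow>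
        f ((1 - t) *\<^sub>R x + t *\<^sub>R y) < (1 - t) * f x + t * f y)"

text \<open>The conjugate may be infinite even at finite \<open>v\<close> (when \<open>G\<close> grows at most linearly).
  The argument is extended so that it also covers \<open>v = \<infinity>\<close>, which arises below from a vanishing
  restricted eigenvalue.\<close>

definition convex_conjugate :: "(real \<Rightarrow> real) \<Rightarrow> ereal \<Rightarrow> ereal" where
  "convex_conjugate G v = (SUP u\<in>{0..}. ereal u * v - ereal (G u))"

definition sup_norm :: "('x \<Rightarrow> real) \<Rightarrow> ereal" where
  "sup_norm f = (SUP x. ereal \<bar>f x\<bar>)"

definition local_set :: "('x \<Rightarrow> real) set \<Rightarrow> ('x \<Rightarrow> real) \<Rightarrow> real \<Rightarrow> ('x \<Rightarrow> real) set" where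
  "local_set F f0 \<eta> = {f \<in> F. sup_norm (f - f0) \<le> ereal \<eta>}"


definition emp_mean :: "nat \<Rightarrow> (nat \<Rightarrow> 'w \<Rightarrow> 'z) \<Rightarrow> ('z \<Rightarrow> real) \<Rightarrow> 'w \<Rightarrow> real" where
  "emp_mean n Z g \<omega> = (\<Sum>i=1..n. g (Z i \<omega>)) / real n"

definition pop_mean :: "'w measure \<Rightarrow> nat \<Rightarrow> (nat \<Rightarrow> 'w \<Rightarrow> 'z) \<Rightarrow> ('z \<Rightarrow> real) \<Rightarrow> real" where
  "pop_mean M n Z g = (\<Sum>i=1..n. \<integral>\<omega>. g (Z i \<omega>) \<partial>M) / real n"

definition excess_risk ::
  "'w measure \<Rightarrow> nat \<Rightarrow> (nat \<Rightarrow> 'w \<Rightarrow> 'z) \<Rightarrow> ('f \<Rightarrow> 'z \<Rightarrow> real) \<Rightarrow> 'f \<Rightarrow> 'f \<Rightarrow> real" where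
  "excess_risk M n Z \<rho> f0 f = pop_mean M n Z (\<lambda>z. \<rho> f z - \<rho> f0 z)"


definition lin_comb :: "('p::finite \<Rightarrow> 'v::real_vector) \<Rightarrow> real^'p \<Rightarrow> 'v" where
  "lin_comb \<psi> \<beta> = (\<Sum>j\<in>UNIV. (\<beta> $ j) *\<^sub>R \<psi> j)"

definition l1_norm :: "real^'p::finite \<Rightarrow> real" where
  "l1_norm \<beta> = (\<Sum>j\<in>UNIV. \<bar>\<beta> $ j\<bar>)"

definition restrict_vec :: "real^'p::finite \<Rightarrow> 'p set \<Rightarrow> real^'p" where
  "restrict_vec \<beta> S = (\<chi> j. if j \<in> S then \<beta> $ j else 0)"

definition supp :: "real^'p::finite \<Rightarrow> 'p set" where
  "supp \<beta> = {j. \<beta> $ j \<noteq> 0}"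

definition elastic_net_objective ::
  "nat \<Rightarrow> (nat \<Rightarrow> 'w \<Rightarrow> 'z) \<Rightarrow> ('v \<Rightarrow> 'z \<Rightarrow> real) \<Rightarrow> ('p::finite \<Rightarrow> 'v::real_vector)
    \<Rightarrow> real \<Rightarrow> real \<Rightarrow> 'w \<Rightarrow> real^'p \<Rightarrow> real" where
  "elastic_net_objective n Z \<rho> \<psi> lam1 lam2 \<omega> \<beta> =
     emp_mean n Z (\<rho> (lin_comb \<psi> \<beta>)) \<omega> + lam1 * l1_norm \<beta> + lam2 * (norm \<beta>)\<^sup>2"


definition cone_const :: "real \<Rightarrow> real \<Rightarrow> real^'p::finite \<Rightarrow> 'p set \<Rightarrow> real" where
  "cone_const lam1 lam2 b S = 3 * (sqrt (card S) + 2 * lam2 * norm (restrict_vec b S) / lam1)"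

text \<open>The minimum is attained whenever the constraint set is nonempty. It is empty
  precisely when \<open>S = {}\<close>, and the value is then \<open>\<infinity>\<close>. On the constraint set
  the denominator does not vanish.\<close>

definition restricted_eigenvalue_sq ::
  "('v \<Rightarrow> real) \<Rightarrow> ('p::finite \<Rightarrow> 'v::real_vector) \<Rightarrow> real \<Rightarrow> real \<Rightarrow> real^'p \<Rightarrow> 'p set \<Rightarrow> ereal" where
  "restricted_eigenvalue_sq nrm \<psi> lam1 lam2 b S =
     (INF \<beta>\<in>{\<beta>. \<beta> \<noteq> 0 \<and> l1_norm (restrict_vec \<beta> (- S)) \<le> cone_const lam1 lam2 b S * norm (restrict_vec \<beta> S)}.
        ereal ((nrm (lin_comb \<psi> \<beta>))\<^sup>2 / (norm (restrict_vec \<beta> S))\<^sup>2))"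

definition restricted_eigenvalue ::
  "('v \<Rightarrow> real) \<Rightarrow> ('p::finite \<Rightarrow> 'v::real_vector) \<Rightarrow> real \<Rightarrow> real \<Rightarrow> real^'p \<Rightarrow> 'p set \<Rightarrow> ereal" where
  "restricted_eigenvalue nrm \<psi> lam1 lam2 b S =
     (let q = restricted_eigenvalue_sq nrm \<psi> lam1 lam2 b S
      in if q = \<infinity> then \<infinity> else ereal (sqrt (real_of_ereal q)))"

text \<open>Division is that of \<open>ereal\<close>: a vanishing restricted eigenvalue gives \<open>\<infinity>\<close> for
  \<open>\<beta> \<noteq> 0\<close>, and an infinite one gives \<open>0\<close>.\<close>

definition est_error ::
  "(real \<Rightarrow> real) \<Rightarrow> ('v \<Rightarrow> real) \<Rightarrow> ('p::finite \<Rightarrow> 'v::real_vector) \<Rightarrow> real \<Rightarrow> real \<Rightarrow> real^'p \<Rightarrow> ereal" where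
  "est_error G nrm \<psi> lam1 lam2 \<beta> =
     convex_conjugate G
       (ereal (4 * lam1 * sqrt (card (supp \<beta>)) + 4 * lam2 * norm \<beta>)
          / restricted_eigenvalue nrm \<psi> lam1 lam2 \<beta> (supp \<beta>))"


definition emp_process ::
  "'w measure \<Rightarrow> nat \<Rightarrow> (nat \<Rightarrow> 'w \<Rightarrow> 'z) \<Rightarrow> ('v \<Rightarrow> 'z \<Rightarrow> real) \<Rightarrow> ('p::finite \<Rightarrow> 'v::real_vector)
    \<Rightarrow> 'w \<Rightarrow> real^'p \<Rightarrow> real" where
  "emp_process M n Z \<rho> \<psi> \<omega> \<beta> =
     (\<Sum>i=1..n. \<rho> (lin_comb \<psi> \<beta>) (Z i \<omega>) - (\<integral>\<omega>'. \<rho> (lin_comb \<psi> \<beta>) (Z i \<omega>') \<partial>M)) / real n"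

definition emp_process_sup ::
  "'w measure \<Rightarrow> nat \<Rightarrow> (nat \<Rightarrow> 'w \<Rightarrow> 'z) \<Rightarrow> ('v \<Rightarrow> 'z \<Rightarrow> real) \<Rightarrow> ('p::finite \<Rightarrow> 'v::real_vector)
    \<Rightarrow> real^'p \<Rightarrow> ereal \<Rightarrow> 'w \<Rightarrow> ereal" where
  "emp_process_sup M n Z \<rho> \<psi> \<beta>s m \<omega> =
     (SUP \<beta>\<in>{\<beta>. ereal (l1_norm (\<beta> - \<beta>s)) \<le> m}.
        ereal \<bar>emp_process M n Z \<rho> \<psi> \<omega> \<beta> - emp_process M n Z \<rho> \<psi> \<omega> \<beta>s\<bar>)"

end

theory Submission
  imports Defs
begin

text \<open>
  On the event \<open>\<tau>\<close>, every \<open>\<beta>\<close> in the \<open>\<ell>\<^sub>1\<close>-ball of radius \<open>M\<^sup>*\<close> around \<open>\<beta>\<^sup>*\<close> whose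
  objective does not exceed that of \<open>\<beta>\<^sup>*\<close> satisfies the bound: either the penalty terms
  on \<open>S\<^sup>*\<close> are at most \<open>(\<Delta>\<^sup>* + \<Xi>(f\<^sup>*))/2\<close>, or \<open>\<beta> - \<beta>\<^sup>*\<close> lies in the cone of the
  restricted eigenvalue, and the inequality \<open>u v \<le> G u + H v\<close> together with the margin
  condition absorbs them. The estimator itself need not lie in the ball, so the bound is
  first applied to the convex combination of \<open>\<beta>hat\<close> and \<open>\<beta>\<^sup>*\<close> with weight
  \<open>M\<^sup>*/(M\<^sup>* + \<parallel>\<beta>hat - \<beta>\<^sup>*\<parallel>\<^sub>1)\<close> on the estimator. As \<open>\<lambda>\<^sub>1 \<ge> 8 \<lambda>\<^sub>0\<close>, that point is within
  \<open>M\<^sup>*/2\<close> of \<open>\<beta>\<^sup>*\<close>, which forces the estimator into the ball, and the bound applies to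
  it directly.
\<close>

section \<open>Linear combinations and convexity of the penalty terms\<close>

lemma lin_comb_add: "lin_comb \<psi> (a + b) = lin_comb \<psi> a + lin_comb \<psi> b"
  by (simp add: lin_comb_def scaleR_add_left sum.distrib)

lemma lin_comb_scaleR: "lin_comb \<psi> (c *\<^sub>R a) = c *\<^sub>R lin_comb \<psi> a"
  by (simp add: lin_comb_def scaleR_sum_right)

lemma lin_comb_diff: "lin_comb \<psi> (a - b) = lin_comb \<psi> a - lin_comb \<psi> b"
  by (simp add: lin_comb_def scaleR_diff_left sum_subtractf)

lemma lin_comb_in_subspace:
  assumes "subspace F" "\<And>j. \<psi> j \<in> F"
  shows "lin_comb \<psi> a \<in> F"
  unfolding lin_comb_def using assms by (intro subspace_sum subspace_scale) auto

lemma l1_norm_nonneg: "0 \<le> l1_norm a"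
  by (simp add: l1_norm_def sum_nonneg)

lemma l1_norm_triangle: "l1_norm (a + b) \<le> l1_norm a + l1_norm b"
  unfolding l1_norm_def sum.distrib[symmetric] by (intro sum_mono) simp

lemma l1_norm_scaleR: "l1_norm (c *\<^sub>R a) = \<bar>c\<bar> * l1_norm a"
  by (simp add: l1_norm_def abs_mult sum_distrib_left)

lemma convex_on_l1_norm: "convex_on UNIV l1_norm"
proof (intro convex_onI)
  fix t :: real and x y :: "real^'p::finite"
  assume t: "0 < t" "t < 1"
  then show "l1_norm ((1 - t) *\<^sub>R x + t *\<^sub>R y) \<le> (1 - t) * l1_norm x + t * l1_norm y"
    using l1_norm_triangle[of "(1 - t) *\<^sub>R x" "t *\<^sub>R y"] by (simp add: l1_norm_scaleR)
qed simp

lemma convex_on_norm_square: "convex_on UNIV (\<lambda>x::'a::real_normed_vector. (norm x)\<^sup>2)"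
proof (intro convex_onI)
  fix t :: real and x y :: 'a
  assume t: "0 < t" "t < 1"
  have "norm ((1 - t) *\<^sub>R x + t *\<^sub>R y) \<le> (1 - t) * norm x + t * norm y"
    using norm_triangle_ineq[of "(1 - t) *\<^sub>R x" "t *\<^sub>R y"] t by simp
  then have "(norm ((1 - t) *\<^sub>R x + t *\<^sub>R y))\<^sup>2 \<le> ((1 - t) * norm x + t * norm y)\<^sup>2"
    by (rule power_mono) simp
  \<comment> \<open>The convexity defect of the real square is written out exactly; it is
    nonnegative for \<open>t\<close> between 0 and 1.\<close>
  also have "\<dots> = (1 - t) * (norm x)\<^sup>2 + t * (norm y)\<^sup>2 - (1 - t) * t * (norm x - norm y)\<^sup>2"
    by (simp add: power2_eq_square algebra_simps)
  also have "\<dots> \<le> (1 - t) * (norm x)\<^sup>2 + t * (norm y)\<^sup>2"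
    using t by simp
  finally show "(norm ((1 - t) *\<^sub>R x + t *\<^sub>R y))\<^sup>2 \<le> (1 - t) * (norm x)\<^sup>2 + t * (norm y)\<^sup>2" .
qed simp

section \<open>Restriction to an index set and the difference of the penalties\<close>

lemma norm_vec_square: "(norm (a::real^'p::finite))\<^sup>2 = (\<Sum>j\<in>UNIV. (a $ j)\<^sup>2)"
  unfolding power2_norm_eq_inner inner_vec_def by (simp add: power2_eq_square)

lemma restrict_vec_diff: "restrict_vec (a - b) S = restrict_vec a S - restrict_vec b S"
  by (simp add: restrict_vec_def vec_eq_iff)

lemma restrict_vec_supp: "restrict_vec b (supp b) = b"
  by (simp add: restrict_vec_def supp_def vec_eq_iff)

lemma norm_restrict_vec_le: "norm (restrict_vec a S) \<le> norm a"
  by (rule norm_le_componentwise_cart) (simp add: restrict_vec_def)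

lemma l1_norm_restrict_vec_split:
  "l1_norm a = l1_norm (restrict_vec a S) + l1_norm (restrict_vec a (- S))"
  unfolding l1_norm_def sum.distrib[symmetric] by (intro sum.cong) (auto simp: restrict_vec_def)

text \<open>Cauchy-Schwarz against the constant 1 on \<open>S\<close>. This is where the square root
  of the sparsity enters the bounds.\<close>

lemma l1_norm_restrict_vec_le:
  "l1_norm (restrict_vec a S) \<le> sqrt (card S) * norm (restrict_vec a S)"
proof (rule power2_le_imp_le)
  have "l1_norm (restrict_vec a S) = (\<Sum>j\<in>S. \<bar>a $ j\<bar> * 1)"
    unfolding l1_norm_def restrict_vec_def by (rule sum.mono_neutral_cong_right) auto
  moreover have "(norm (restrict_vec a S))\<^sup>2 = (\<Sum>j\<in>S. \<bar>a $ j\<bar>\<^sup>2)"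
    unfolding norm_vec_square restrict_vec_def by (rule sum.mono_neutral_cong_right) auto
  ultimately show "(l1_norm (restrict_vec a S))\<^sup>2 \<le> (sqrt (card S) * norm (restrict_vec a S))\<^sup>2"
    using Cauchy_Schwarz_ineq_sum[of "\<lambda>j. \<bar>a $ j\<bar>" "\<lambda>_. 1" S]
    by (simp add: power_mult_distrib mult.commute)
qed simp

text \<open>Since \<open>b\<close> vanishes off its support, the \<ell>1 part loses the full size of
  \<open>d\<close> there, while on the support the triangle inequality applies. In the expansion of
  the squared norm of \<open>b + d\<close>, the cross term sees \<open>d\<close> only on the support
  for the same reason, and of the square of \<open>d\<close> only the part on \<open>S\<close> is
  kept.\<close>

lemma elastic_net_penalty_diff_le:
  fixes b \<beta> :: "real^'p::finite"
  assumes lam1: "0 < lam1" and lam2: "0 < lam2"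
  defines "S \<equiv> supp b"
  defines "d \<equiv> \<beta> - b"
  shows "lam1 * (l1_norm b - l1_norm \<beta>) + lam2 * ((norm b)\<^sup>2 - (norm \<beta>)\<^sup>2)
    \<le> lam1 * (l1_norm (restrict_vec d S) - l1_norm (restrict_vec d (- S)))
      + 2 * lam2 * norm b * norm (restrict_vec d S) - lam2 * (norm (restrict_vec d S))\<^sup>2"
proof -
  have l1: "l1_norm b - l1_norm \<beta> \<le> l1_norm (restrict_vec d S) - l1_norm (restrict_vec d (- S))"
    unfolding l1_norm_def sum_subtractf[symmetric]
    by (intro sum_mono) (auto simp: restrict_vec_def S_def d_def supp_def)
  have "\<beta> = b + d" by (simp add: d_def)
  then have "(norm b)\<^sup>2 - (norm \<beta>)\<^sup>2 = - 2 * inner d b - (norm d)\<^sup>2"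
    by (simp add: power2_norm_eq_inner inner_add_left inner_add_right inner_commute)
  also have "inner d b = inner (restrict_vec d S) b"
    unfolding inner_vec_def by (intro sum.cong) (auto simp: restrict_vec_def S_def supp_def)
  also have "- 2 * inner (restrict_vec d S) b - (norm d)\<^sup>2
      \<le> 2 * norm b * norm (restrict_vec d S) - (norm (restrict_vec d S))\<^sup>2"
  proof (rule diff_mono)
    have "- inner (restrict_vec d S) b \<le> norm b * norm (restrict_vec d S)"
      using Cauchy_Schwarz_ineq2[of "restrict_vec d S" b] unfolding mult.commute[of "norm b"] by linarith
    then show "- 2 * inner (restrict_vec d S) b \<le> 2 * norm b * norm (restrict_vec d S)"
      by linarith
    show "(norm (restrict_vec d S))\<^sup>2 \<le> (norm d)\<^sup>2"
      by (intro power_mono norm_restrict_vec_le norm_ge_zero)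
  qed
  finally have l2: "(norm b)\<^sup>2 - (norm \<beta>)\<^sup>2
      \<le> 2 * norm b * norm (restrict_vec d S) - (norm (restrict_vec d S))\<^sup>2" .
  show ?thesis
    using add_mono[OF mult_left_mono[OF l1, of lam1] mult_left_mono[OF l2, of lam2]] lam1 lam2
    by (simp add: algebra_simps)
qed

section \<open>Convex conjugate, restricted eigenvalue and the norm on \<open>F\<close>\<close>

text \<open>The Fenchel-Young inequality, moved from \<open>ereal\<close> to the reals by a finite
  bound \<open>h\<close> on the conjugate.\<close>

lemma convex_conjugate_ge:
  assumes "0 \<le> u" "convex_conjugate G (ereal v) \<le> ereal h"
  shows "u * v - G u \<le> h"
proof -
  have "ereal u * ereal v - ereal (G u) \<le> convex_conjugate G (ereal v)"
    unfolding convex_conjugate_def using assms(1) by (intro SUP_upper) simp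
  then have "ereal u * ereal v - ereal (G u) \<le> ereal h"
    using assms(2) by (rule order_trans)
  then show ?thesis by simp
qed

text \<open>The point \<open>u = 0\<close> contributes 0 to the supremum, even at
  \<open>v = \<infinity>\<close>, because \<open>0 * \<infinity> = 0\<close> in
  \<open>ereal\<close>.\<close>

lemma convex_conjugate_nonneg:
  assumes "G 0 = 0"
  shows "0 \<le> convex_conjugate G v"
  unfolding convex_conjugate_def
  by (rule order_trans[OF _ SUP_upper[of 0]]) (auto simp: assms zero_ereal_def[symmetric])

text \<open>The vector \<open>d\<close> itself competes in the infimum. This makes the eigenvalue a
  real number \<open>k\<close>, so the infinite branch of its definition is excluded, and it bounds
  \<open>k\<close> by the quotient at \<open>d\<close>.\<close>

lemma restricted_eigenvalue_bound:
  fixes d :: "real^'p::finite"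
  assumes nonneg: "\<And>a. 0 \<le> nrm (lin_comb \<psi> a)"
    and d: "restrict_vec d S \<noteq> 0"
    and cone: "l1_norm (restrict_vec d (- S)) \<le> cone_const lam1 lam2 b S * norm (restrict_vec d S)"
    and pos: "0 < restricted_eigenvalue nrm \<psi> lam1 lam2 b S"
  obtains k where "0 < k" "restricted_eigenvalue nrm \<psi> lam1 lam2 b S = ereal k"
    "k * norm (restrict_vec d S) \<le> nrm (lin_comb \<psi> d)"
proof -
  define q where "q = restricted_eigenvalue_sq nrm \<psi> lam1 lam2 b S"
  define N where "N = norm (restrict_vec d S)"
  have N: "0 < N" using d by (simp add: N_def)
  have "d \<noteq> 0" using d by (auto simp: restrict_vec_def vec_eq_iff split: if_splits)
  then have q_le: "q \<le> ereal ((nrm (lin_comb \<psi> d))\<^sup>2 / N\<^sup>2)"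
    unfolding q_def restricted_eigenvalue_sq_def N_def using cone by (intro INF_lower) simp
  have "0 \<le> q"
    unfolding q_def restricted_eigenvalue_sq_def by (intro INF_greatest) simp
  then obtain r where r: "q = ereal r" "0 \<le> r"
    using q_le by (cases q) auto
  have eq: "restricted_eigenvalue nrm \<psi> lam1 lam2 b S = ereal (sqrt r)"
    using r by (simp add: restricted_eigenvalue_def q_def[symmetric])
  have "r * N\<^sup>2 \<le> (nrm (lin_comb \<psi> d))\<^sup>2"
    using q_le N r by (simp add: field_simps)
  then have "(sqrt r * N)\<^sup>2 \<le> (nrm (lin_comb \<psi> d))\<^sup>2"
    using r by (simp add: power_mult_distrib)
  then have "sqrt r * N \<le> nrm (lin_comb \<psi> d)"
    by (rule power2_le_imp_le) (rule nonneg)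
  with eq pos show ?thesis by (intro that[of "sqrt r"]) (auto simp: N_def)
qed

lemma norm_on_diff_triangle:
  assumes "subspace F" "is_norm_on F nrm" "f \<in> F" "g \<in> F" "h \<in> F"
  shows "nrm (f - g) \<le> nrm (f - h) + nrm (g - h)"
proof -
  have fh: "f - h \<in> F" and gh: "g - h \<in> F" and hg: "(- 1) *\<^sub>R (g - h) \<in> F"
    using assms by (auto intro: subspace_diff subspace_scale)
  have "nrm ((f - h) + (- 1) *\<^sub>R (g - h)) \<le> nrm (f - h) + nrm ((- 1) *\<^sub>R (g - h))"
    using assms(2) fh hg unfolding is_norm_on_def by blast
  moreover have "nrm ((- 1) *\<^sub>R (g - h)) = \<bar>- 1\<bar> * nrm (g - h)"
    using assms(2) gh unfolding is_norm_on_def by blast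
  ultimately show ?thesis by (simp add: scaleR_minus_left)
qed

section \<open>Deterministic bound from the basic inequality\<close>

text \<open>Here \<open>x\<close> and \<open>xb\<close> stand for the excess risks at
  \<open>\<beta>\<close> and \<open>b\<close>, and \<open>\<delta>\<close> in \<open>basic\<close>
  for a bound on the increment of the empirical process. The case split compares \<open>A\<close>,
  which dominates the penalty terms on the support, with half of
  \<open>\<delta> + xb\<close>.\<close>

lemma elastic_net_deterministic_bound:
  fixes b \<beta> :: "real^'p::finite" and \<psi> :: "'p \<Rightarrow> 'v::real_vector"
  assumes F: "subspace F" "is_norm_on F nrm" "\<And>j. \<psi> j \<in> F" "f0 \<in> F"
    and lam: "0 < lam1" "0 < lam2"
    and basic: "x + lam1 * l1_norm \<beta> + lam2 * (norm \<beta>)\<^sup>2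
      \<le> \<delta> + xb + lam1 * l1_norm b + lam2 * (norm b)\<^sup>2"
    and margin: "G (nrm (lin_comb \<psi> \<beta> - f0)) \<le> x" "G (nrm (lin_comb \<psi> b - f0)) \<le> xb"
    and xb: "0 \<le> xb" and h: "0 \<le> h"
    and \<phi>_pos: "0 < restricted_eigenvalue nrm \<psi> lam1 lam2 b (supp b)"
    and conj: "convex_conjugate G (ereal (4 * lam1 * sqrt (card (supp b)) + 4 * lam2 * norm b)
        / restricted_eigenvalue nrm \<psi> lam1 lam2 b (supp b)) \<le> ereal h"
    and \<delta>: "2 * \<delta> = 3 * xb + 2 * h"
    and x: "0 \<le> x"
  shows "x + lam1 * l1_norm (\<beta> - b) + lam2 * (norm (restrict_vec (\<beta> - b) (supp b)))\<^sup>2 \<le> 4 * \<delta>"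
proof -
  define S where "S = supp b"
  define d where "d = \<beta> - b"
  define N where "N = norm (restrict_vec d S)"
  define A where "A = (lam1 * sqrt (card S) + 2 * lam2 * norm b) * N"
  define l where "l = l1_norm (restrict_vec d S)"
  define lc where "lc = l1_norm (restrict_vec d (- S))"
  have l: "lam1 * l \<le> lam1 * sqrt (card S) * N"
    using lam l1_norm_restrict_vec_le[of d S] by (simp add: l_def N_def)
  have split: "l1_norm d = l + lc"
    unfolding l_def lc_def by (rule l1_norm_restrict_vec_split)
  have pen: "x + lam1 * lc + lam2 * N\<^sup>2 \<le> \<delta> + xb + lam1 * l + 2 * lam2 * norm b * N"
    using elastic_net_penalty_diff_le[OF lam, of b \<beta>] basic
    unfolding S_def[symmetric] d_def[symmetric] N_def[symmetric] l_def[symmetric] lc_def[symmetric]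
    by (simp add: algebra_simps)
  have nonneg: "0 \<le> N" "0 \<le> lam2 * N\<^sup>2" "0 \<le> lam1 * sqrt (card S) * N" "0 \<le> lam2 * norm b * N"
    using lam by (simp_all add: N_def)
  have A: "A = lam1 * sqrt (card S) * N + 2 * (lam2 * norm b * N)"
    by (simp add: A_def algebra_simps)
  show ?thesis
    unfolding S_def[symmetric] d_def[symmetric] N_def[symmetric] split
  proof (cases "2 * A \<le> \<delta> + xb")
    case True
    \<comment> \<open>Adding \<open>lam1 * l\<close> to both sides of \<open>pen\<close> gives at
      most \<open>\<delta> + xb + 2 * A\<close>, hence at most \<open>2 * (\<delta> + xb)\<close>,
      and \<open>xb \<le> \<delta>\<close>.\<close>
    then show "x + lam1 * (l + lc) + lam2 * N\<^sup>2 \<le> 4 * \<delta>"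
      using pen l A nonneg \<delta> xb h by (simp add: distrib_left)
  next
    case False
    have "A \<noteq> 0" using False \<delta> xb h by auto
    then have dS: "restrict_vec d S \<noteq> 0" by (auto simp: A_def N_def)
    \<comment> \<open>By \<open>pen\<close>, \<open>lam1 * lc\<close> is at most
      \<open>\<delta> + xb + A\<close>, and \<open>\<delta> + xb < 2 * A\<close> in this case. This
      is the source of the factor 3 in \<open>cone_const\<close>.\<close>
    have "lam1 * lc \<le> 3 * A"
      using False pen l A nonneg x by simp
    also have "\<dots> = lam1 * (cone_const lam1 lam2 b S * N)"
      using lam by (simp add: A_def cone_const_def S_def restrict_vec_supp field_simps)
    finally have cone: "lc \<le> cone_const lam1 lam2 b S * N"
      using lam by simp
    have in_F: "lin_comb \<psi> a \<in> F" for a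
      using F by (intro lin_comb_in_subspace) auto
    have nrm_nonneg: "0 \<le> nrm f" if "f \<in> F" for f
      using F(2) that by (simp add: is_norm_on_def)
    obtain k where k: "0 < k" "restricted_eigenvalue nrm \<psi> lam1 lam2 b S = ereal k"
      "k * N \<le> nrm (lin_comb \<psi> d)"
      using restricted_eigenvalue_bound[of nrm \<psi> d S lam1 lam2 b] nrm_nonneg[OF in_F] dS cone
        \<phi>_pos by (auto simp: S_def lc_def N_def)
    define v where "v = (4 * lam1 * sqrt (card S) + 4 * lam2 * norm b) / k"
    define u where "u = nrm (lin_comb \<psi> \<beta> - f0)"
    define ub where "ub = nrm (lin_comb \<psi> b - f0)"
    have v: "0 \<le> v" using lam k by (simp add: v_def)
    have conj': "convex_conjugate G (ereal v) \<le> ereal h"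
      using conj k by (simp add: v_def S_def)
    have "u \<ge> 0" "ub \<ge> 0"
      unfolding u_def ub_def using F(1) F(4) in_F by (auto intro!: nrm_nonneg subspace_diff)
    then have young: "u * v \<le> x + h" "ub * v \<le> xb + h"
      using convex_conjugate_ge[OF _ conj'] margin unfolding u_def ub_def by fastforce+
    \<comment> \<open>The triangle inequality through \<open>f0\<close> splits the norm into the two
      distances that the margin condition controls. Fenchel-Young is applied to each, so
      \<open>h\<close> occurs twice below.\<close>
    have "k * N \<le> u + ub"
      using k(3) norm_on_diff_triangle[OF F(1,2) in_F in_F F(4), of \<beta> b]
      by (simp add: d_def lin_comb_diff u_def ub_def)
    then have "v * (k * N) \<le> v * (u + ub)"
      using v by (rule mult_left_mono)
    also have "v * (k * N) = 4 * (lam1 * sqrt (card S) * N) + 4 * (lam2 * norm b * N)"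
      using k by (simp add: v_def field_simps)
    finally have "4 * (lam1 * sqrt (card S) * N) + 4 * (lam2 * norm b * N) \<le> x + xb + 2 * h"
      using young by (simp add: algebra_simps)
    \<comment> \<open>The left side of the goal is now at most \<open>2 * \<delta> + x / 2\<close>.
      As its other summands are nonnegative, \<open>x / 2\<close> is at most half of that left side
      and is absorbed, which doubles the constant to 4.\<close>
    moreover have "0 \<le> lam1 * (l + lc)"
      using lam l1_norm_nonneg[of d] split by simp
    ultimately show "x + lam1 * (l + lc) + lam2 * N\<^sup>2 \<le> 4 * \<delta>"
      using pen l \<delta> nonneg by (simp add: distrib_left)
  qed
qed

section \<open>Convexity of the objective and the risk identities\<close>

text \<open>The map from coefficients to functions is linear with values in \<open>F\<close>, so it
  preserves convexity of the loss at each observed point; averages and nonnegative multiples of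
  convex terms stay convex.\<close>

lemma convex_on_elastic_net_objective:
  fixes \<psi> :: "'p::finite \<Rightarrow> 'v::real_vector"
  assumes F: "subspace F" "\<And>j. \<psi> j \<in> F"
    and lam: "0 < lam1" "0 < lam2"
    and loss: "\<And>i. i \<in> {1..n} \<Longrightarrow> convex_on F (\<lambda>f. \<rho> f (Z i \<omega>))"
  shows "convex_on UNIV (elastic_net_objective n Z \<rho> \<psi> lam1 lam2 \<omega>)"
proof -
  have "convex_on UNIV (\<lambda>\<beta>. emp_mean n Z (\<rho> (lin_comb \<psi> \<beta>)) \<omega>)"
  proof (intro convex_onI)
    fix t :: real and a b :: "real^'p"
    assume t: "0 < t" "t < 1"
    have "\<rho> (lin_comb \<psi> ((1 - t) *\<^sub>R a + t *\<^sub>R b)) (Z i \<omega>)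
        \<le> (1 - t) * \<rho> (lin_comb \<psi> a) (Z i \<omega>) + t * \<rho> (lin_comb \<psi> b) (Z i \<omega>)" if "i \<in> {1..n}" for i
      unfolding lin_comb_add lin_comb_scaleR
      using t F by (intro convex_onD[OF loss[OF that]] lin_comb_in_subspace) auto
    then have "(\<Sum>i=1..n. \<rho> (lin_comb \<psi> ((1 - t) *\<^sub>R a + t *\<^sub>R b)) (Z i \<omega>))
        \<le> (\<Sum>i=1..n. (1 - t) * \<rho> (lin_comb \<psi> a) (Z i \<omega>) + t * \<rho> (lin_comb \<psi> b) (Z i \<omega>))"
      by (rule sum_mono)
    then have "emp_mean n Z (\<rho> (lin_comb \<psi> ((1 - t) *\<^sub>R a + t *\<^sub>R b))) \<omega>
        \<le> (\<Sum>i=1..n. (1 - t) * \<rho> (lin_comb \<psi> a) (Z i \<omega>) + t * \<rho> (lin_comb \<psi> b) (Z i \<omega>)) / real n"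
      unfolding emp_mean_def by (intro divide_right_mono) simp_all
    then show "emp_mean n Z (\<rho> (lin_comb \<psi> ((1 - t) *\<^sub>R a + t *\<^sub>R b))) \<omega>
        \<le> (1 - t) * emp_mean n Z (\<rho> (lin_comb \<psi> a)) \<omega> + t * emp_mean n Z (\<rho> (lin_comb \<psi> b)) \<omega>"
      by (simp only: emp_mean_def sum.distrib sum_distrib_left[symmetric] add_divide_distrib
          times_divide_eq_right)
  qed simp
  then show ?thesis
    unfolding elastic_net_objective_def using lam
    by (intro convex_on_add convex_on_cmul convex_on_l1_norm convex_on_norm_square) auto
qed

lemma excess_risk_eq:
  assumes "\<And>i. i \<in> {1..n} \<Longrightarrow> integrable M (\<lambda>\<omega>. \<rho> f (Z i \<omega>))"
    and "\<And>i. i \<in> {1..n} \<Longrightarrow> integrable M (\<lambda>\<omega>. \<rho> f0 (Z i \<omega>))"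
  shows "excess_risk M n Z \<rho> f0 f = pop_mean M n Z (\<rho> f) - pop_mean M n Z (\<rho> f0)"
  using assms
  by (simp add: excess_risk_def pop_mean_def sum_subtractf diff_divide_distrib[symmetric])

text \<open>With this form, comparing objectives becomes comparing excess risks up to an increment
  of the process.\<close>

lemma emp_process_eq:
  "emp_process M n Z \<rho> \<psi> \<omega> \<beta>
    = emp_mean n Z (\<rho> (lin_comb \<psi> \<beta>)) \<omega> - pop_mean M n Z (\<rho> (lin_comb \<psi> \<beta>))"
  by (simp add: emp_process_def emp_mean_def pop_mean_def sum_subtractf diff_divide_distrib)

text \<open>Measurability places every observation in the sample space, where convexity of the loss
  is assumed.\<close>

lemma indep_vars_mem_space:
  assumes "prob_space M" "prob_space.indep_vars M N Z I" "i \<in> I" "\<omega> \<in> space M"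
  shows "Z i \<omega> \<in> space (N i)"
  using assms measurable_space[of "Z i" M "N i" \<omega>] by (auto simp: prob_space.indep_vars_def)

section \<open>The estimator on the event \<open>\<tau>\<close>\<close>

theorem theorem1:
  fixes M :: "'w measure" and NX :: "'x measure" and Y :: "real set"
    and n :: nat and Z :: "nat \<Rightarrow> 'w \<Rightarrow> 'x \<times> real"
    and F :: "('x \<Rightarrow> real) set" and nrm :: "('x \<Rightarrow> real) \<Rightarrow> real"
    and \<rho> :: "('x \<Rightarrow> real) \<Rightarrow> 'x \<times> real \<Rightarrow> real"
    and f0 fstar :: "'x \<Rightarrow> real"
    and \<psi> :: "'p::finite \<Rightarrow> 'x \<Rightarrow> real"
    and \<Phi> :: "(real^'p) set" and \<Gamma> :: "'p set set"
    and lam0 lam1 lam2 \<eta> :: real and G :: "real \<Rightarrow> real"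
    and \<beta>hat :: "'w \<Rightarrow> real^'p" and \<beta>star :: "real^'p"
    and \<Xi> :: "('x \<Rightarrow> real) \<Rightarrow> real"
    and \<phi>star \<Delta>star Mstar :: ereal and \<tau> :: "'w set"
  assumes prob: "prob_space M"
    and n_pos: "1 \<le> n"
    and space_X: "space NX = UNIV"
    and sample: "prob_space.indep_vars M (\<lambda>_. NX \<Otimes>\<^sub>M restrict_space borel Y) Z {1..n}"
    and F_space: "subspace F" and F_norm: "is_norm_on F nrm"
    and loss_convex: "\<And>z. z \<in> UNIV \<times> Y \<Longrightarrow> convex_on F (\<lambda>f. \<rho> f z)"
    and loss_integrable: "\<And>f i. f \<in> F \<Longrightarrow> i \<in> {1..n} \<Longrightarrow> integrable M (\<lambda>\<omega>. \<rho> f (Z i \<omega>))"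
    and f0_min: "is_arg_min (\<lambda>f. pop_mean M n Z (\<rho> f)) (\<lambda>f. f \<in> F) f0"
    and f0_unique: "\<And>f. is_arg_min (\<lambda>f. pop_mean M n Z (\<rho> f)) (\<lambda>f. f \<in> F) f \<Longrightarrow> f = f0"
    and \<Xi>_eq: "\<Xi> = excess_risk M n Z \<rho> f0"
    and \<psi>_in: "\<And>j. \<psi> j \<in> F"
    and \<Phi>_convex: "convex \<Phi>"
    and lam0_pos: "0 < lam0" and lam1_pos: "0 < lam1" and lam2_pos: "0 < lam2"
    and lam1_ge: "8 * lam0 \<le> lam1"
    and \<eta>_pos: "0 < \<eta>"
    and \<beta>hat_min: "\<And>\<omega>. \<omega> \<in> space M \<Longrightarrow>
        is_arg_min (elastic_net_objective n Z \<rho> \<psi> lam1 lam2 \<omega>) (\<lambda>\<beta>. \<beta> \<in> \<Phi>) (\<beta>hat \<omega>)"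
    and G_convex: "strictly_convex_on {0..} G" and G_zero: "G 0 = 0"
    and \<beta>star_oracle: "is_arg_min (\<lambda>\<beta>. 3 * ereal (\<Xi> (lin_comb \<psi> \<beta>)) + 2 * est_error G nrm \<psi> lam1 lam2 \<beta>)
        (\<lambda>\<beta>. supp \<beta> \<in> \<Gamma>) \<beta>star"
    and \<beta>star_in: "\<beta>star \<in> \<Phi>"
    and fstar_eq: "fstar = lin_comb \<psi> \<beta>star"
    and \<phi>star_eq: "\<phi>star = restricted_eigenvalue nrm \<psi> lam1 lam2 \<beta>star (supp \<beta>star)"
    and \<Delta>star_eq: "\<Delta>star = (3 * ereal (\<Xi> fstar) + 2 * convex_conjugate G
        (ereal (4 * lam1 * sqrt (card (supp \<beta>star)) + 4 * lam2 * norm \<beta>star) / \<phi>star)) / 2"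
    and Mstar_eq: "Mstar = \<Delta>star / ereal lam0"
    and Mstar_pos: "0 < Mstar"
    and margin: "\<And>f. f \<in> local_set F f0 \<eta> \<Longrightarrow> G (nrm (f - f0)) \<le> \<Xi> f"
    and fstar_local: "fstar \<in> local_set F f0 \<eta>"
    and ball_local: "\<And>\<beta>. ereal (l1_norm (\<beta> - \<beta>star)) \<le> Mstar \<Longrightarrow> lin_comb \<psi> \<beta> \<in> local_set F f0 \<eta>"
    and \<phi>star_pos: "0 < \<phi>star"
    and \<tau>_eq: "\<tau> = {\<omega> \<in> space M. emp_process_sup M n Z \<rho> \<psi> \<beta>star Mstar \<omega> \<le> ereal lam0 * Mstar}"
  shows "(\<forall>\<omega>\<in>\<tau>.
      ereal (\<Xi> (lin_comb \<psi> (\<beta>hat \<omega>)) + lam1 * l1_norm (\<beta>hat \<omega> - \<beta>star)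
        + lam2 * (norm (restrict_vec (\<beta>hat \<omega>) (supp \<beta>star) - restrict_vec \<beta>star (supp \<beta>star)))\<^sup>2)
      \<le> 4 * \<Delta>star) \<and>
    4 * \<Delta>star = 6 * ereal (\<Xi> fstar) + 4 * convex_conjugate G
        (ereal (4 * lam1 * sqrt (card (supp \<beta>star)) + 4 * lam2 * norm \<beta>star) / \<phi>star)"
proof (intro conjI ballI)
  define h where "h = convex_conjugate G
        (ereal (4 * lam1 * sqrt (card (supp \<beta>star)) + 4 * lam2 * norm \<beta>star) / \<phi>star)"
  \<comment> \<open>This excludes \<open>h = -\<infinity>\<close>, so only the real case and
    \<open>h = \<infinity>\<close> remain in the \<open>ereal\<close> arithmetic. In the latter the
    bound is trivial.\<close>
  have h_nonneg: "0 \<le> h"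
    unfolding h_def using G_zero by (rule convex_conjugate_nonneg)
  show "4 * \<Delta>star = 6 * ereal (\<Xi> fstar) + 4 * convex_conjugate G
        (ereal (4 * lam1 * sqrt (card (supp \<beta>star)) + 4 * lam2 * norm \<beta>star) / \<phi>star)"
    unfolding \<Delta>star_eq h_def[symmetric] using h_nonneg by (cases h) auto
  fix \<omega> assume "\<omega> \<in> \<tau>"
  then have \<omega>: "\<omega> \<in> space M"
    and sup_le: "emp_process_sup M n Z \<rho> \<psi> \<beta>star Mstar \<omega> \<le> ereal lam0 * Mstar"
    by (auto simp: \<tau>_eq)
  let ?obj = "elastic_net_objective n Z \<rho> \<psi> lam1 lam2 \<omega>"
  show "ereal (\<Xi> (lin_comb \<psi> (\<beta>hat \<omega>)) + lam1 * l1_norm (\<beta>hat \<omega> - \<beta>star)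
        + lam2 * (norm (restrict_vec (\<beta>hat \<omega>) (supp \<beta>star) - restrict_vec \<beta>star (supp \<beta>star)))\<^sup>2)
      \<le> 4 * \<Delta>star"
  proof (cases "h = \<infinity>")
    case True
    then show ?thesis by (simp add: \<Delta>star_eq h_def[symmetric])
  next
    case False
    then obtain hr where hr: "h = ereal hr" "0 \<le> hr"
      using h_nonneg by (cases h) auto
    define \<delta> where "\<delta> = (3 * \<Xi> fstar + 2 * hr) / 2"
    have \<Delta>: "\<Delta>star = ereal \<delta>"
      by (simp add: \<Delta>star_eq h_def[symmetric] hr \<delta>_def)
    \<comment> \<open>With this radius, the bound \<open>lam0 * m\<close> for the process on the
      event is exactly \<open>\<delta>\<close>.\<close>
    define m where "m = \<delta> / lam0"
    have m: "Mstar = ereal m" "lam0 * m = \<delta>"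
      using lam0_pos by (simp_all add: Mstar_eq \<Delta> m_def)
    have m_pos: "0 < m" using Mstar_pos m by simp
    have in_F: "lin_comb \<psi> \<beta> \<in> F" for \<beta>
      using F_space \<psi>_in by (rule lin_comb_in_subspace)
    have f0: "f0 \<in> F" and f0_le: "f \<in> F \<Longrightarrow> pop_mean M n Z (\<rho> f0) \<le> pop_mean M n Z (\<rho> f)" for f
      using f0_min by (auto simp: is_arg_min_linorder)
    have \<Xi>: "\<Xi> f = pop_mean M n Z (\<rho> f) - pop_mean M n Z (\<rho> f0)" if "f \<in> F" for f
      unfolding \<Xi>_eq using loss_integrable that f0 by (intro excess_risk_eq) auto
    have \<Xi>_nonneg: "0 \<le> \<Xi> f" if "f \<in> F" for f
      using \<Xi>[OF that] f0_le[OF that] by simp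

    \<comment> \<open>Stated for arbitrary \<open>\<beta>\<close> because it is used twice: for a
      point between \<open>\<beta>star\<close> and the estimator, and then for the
      estimator.\<close>
    have bound: "\<Xi> (lin_comb \<psi> \<beta>) + lam1 * l1_norm (\<beta> - \<beta>star)
        + lam2 * (norm (restrict_vec (\<beta> - \<beta>star) (supp \<beta>star)))\<^sup>2 \<le> 4 * \<delta>"
      if ball: "l1_norm (\<beta> - \<beta>star) \<le> m" and obj: "?obj \<beta> \<le> ?obj \<beta>star" for \<beta>
    proof -
      have "ereal \<bar>emp_process M n Z \<rho> \<psi> \<omega> \<beta> - emp_process M n Z \<rho> \<psi> \<omega> \<beta>star\<bar>
          \<le> emp_process_sup M n Z \<rho> \<psi> \<beta>star Mstar \<omega>"
        unfolding emp_process_sup_def using ball m by (intro SUP_upper) simp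
      also note sup_le
      finally have "\<bar>emp_process M n Z \<rho> \<psi> \<omega> \<beta> - emp_process M n Z \<rho> \<psi> \<omega> \<beta>star\<bar> \<le> \<delta>"
        using m by simp
      \<comment> \<open>Empirical risk is population risk plus the process. The population risk of
        \<open>f0\<close> occurs on both sides and cancels.\<close>
      then have basic: "\<Xi> (lin_comb \<psi> \<beta>) + lam1 * l1_norm \<beta> + lam2 * (norm \<beta>)\<^sup>2
          \<le> \<delta> + \<Xi> fstar + lam1 * l1_norm \<beta>star + lam2 * (norm \<beta>star)\<^sup>2"
        using obj unfolding emp_process_eq elastic_net_objective_def fstar_eq \<Xi>[OF in_F] by simp
      have "G (nrm (lin_comb \<psi> \<beta> - f0)) \<le> \<Xi> (lin_comb \<psi> \<beta>)"
        using ball m by (intro margin ball_local) simp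
      moreover have "G (nrm (lin_comb \<psi> \<beta>star - f0)) \<le> \<Xi> fstar"
        using margin[OF fstar_local] by (simp add: fstar_eq)
      ultimately show ?thesis
        using basic F_space F_norm \<psi>_in f0 lam1_pos lam2_pos \<Xi>_nonneg in_F hr \<phi>star_pos
        by (intro elastic_net_deterministic_bound[where F = F and nrm = nrm and \<psi> = \<psi> and G = G
              and h = hr and xb = "\<Xi> fstar" and ?f0.0 = f0])
          (auto simp: fstar_eq \<phi>star_eq \<delta>_def h_def)
    qed

    have loss: "convex_on F (\<lambda>f. \<rho> f (Z i \<omega>))" if "i \<in> {1..n}" for i
      using indep_vars_mem_space[OF prob sample that \<omega>] space_X
      by (intro loss_convex) (simp add: space_pair_measure space_restrict_space)
    have obj_convex: "convex_on UNIV ?obj"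
      using F_space \<psi>_in lam1_pos lam2_pos loss by (rule convex_on_elastic_net_objective)
    have obj_hat: "?obj (\<beta>hat \<omega>) \<le> ?obj \<beta>star"
      using \<beta>hat_min[OF \<omega>] \<beta>star_in by (simp add: is_arg_min_linorder)

    define r where "r = l1_norm (\<beta>hat \<omega> - \<beta>star)"
    have r: "0 \<le> r" unfolding r_def by (rule l1_norm_nonneg)
    \<comment> \<open>Then \<open>t * r = m * r / (m + r)\<close>, which is below \<open>m\<close>
      for every \<open>r\<close>, and it is at most \<open>m / 2\<close> exactly when
      \<open>r \<le> m\<close>.\<close>
    define t where "t = m / (m + r)"
    have t: "0 < t" "t \<le> 1" using r m_pos by (simp_all add: t_def)
    define \<beta> where "\<beta> = (1 - t) *\<^sub>R \<beta>star + t *\<^sub>R \<beta>hat \<omega>"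
    have "\<beta> - \<beta>star = t *\<^sub>R (\<beta>hat \<omega> - \<beta>star)"
      by (simp add: \<beta>_def algebra_simps)
    then have dist: "l1_norm (\<beta> - \<beta>star) = t * r"
      using t by (simp add: l1_norm_scaleR r_def)
    have "?obj \<beta> \<le> (1 - t) * ?obj \<beta>star + t * ?obj (\<beta>hat \<omega>)"
      unfolding \<beta>_def using t by (intro convex_onD[OF obj_convex]) auto
    also have "\<dots> \<le> (1 - t) * ?obj \<beta>star + t * ?obj \<beta>star"
      using obj_hat t by simp
    finally have obj: "?obj \<beta> \<le> ?obj \<beta>star" by (simp add: algebra_simps)
    have "t * r \<le> m"
      using r m_pos by (simp add: t_def field_simps)
    with bound[OF _ obj] dist have "\<Xi> (lin_comb \<psi> \<beta>) + lam1 * (t * r)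
        + lam2 * (norm (restrict_vec (\<beta> - \<beta>star) (supp \<beta>star)))\<^sup>2 \<le> 4 * \<delta>"
      by simp
    moreover have "0 \<le> lam2 * (norm (restrict_vec (\<beta> - \<beta>star) (supp \<beta>star)))\<^sup>2"
      using lam2_pos by simp
    moreover have "8 * lam0 * (t * r) \<le> lam1 * (t * r)"
      using lam1_ge t r by (intro mult_right_mono) auto
    \<comment> \<open>Dropping the nonnegative risk and ridge terms leaves
      \<open>lam1 * (t * r) \<le> 4 * \<delta>\<close>, and \<open>\<delta> = lam0 * m\<close>. The
      factor 8 against 4 yields half the radius.\<close>
    ultimately have "8 * lam0 * (t * r) \<le> 4 * (lam0 * m)"
      using \<Xi>_nonneg[OF in_F, of \<beta>] m by linarith
    then have "2 * (t * r) \<le> m"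
      using lam0_pos by (simp add: mult.commute)
    then have "r \<le> m"
      using m_pos r by (simp add: t_def field_simps)
    then show ?thesis
      using bound[OF _ obj_hat] by (simp add: \<Delta> r_def restrict_vec_diff)
  qed
qed

end
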